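(* Let $\alpha\subset\beta\subset\delta$ be stable shapes with $\beta/\alpha$ a stable horizontal strip and $\delta/\beta$ a single box. Let $c$ be the column of the box $\delta/\beta$ and $H$ the set of columns containing boxes of $\beta/\alpha$. Define the stable shape $\gamma$ covering $\alpha$ as follows: if $c\in H$, $\gamma/\alpha$ is the box of column $c$ (addable to $\alpha$); if $c\notin H$, let $c'$ be the smallest element of $H$ greater than $c$ and let $\gamma/\alpha$ be the box of column $c'$. Then $\gamma\subset\delta$, $\delta/\gamma$ is a stable horizontal strip, and hopscotch applied to the one-box tableau $P=\delta/\beta$ and the stable horizontal strip $Q=\beta/\alpha$ gives $\mathcal{H}(P;Q)=(T;U)$ with $T$ the one-box tableau $\gamma/\alpha$ and $U$ the stable horizontal strip $\delta/\gamma$; i.e. $\gamma=\mathcal{H}(\alpha,\beta,\delta)$.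
   Context: Stable shapes are finite weakly decreasing sequences of integers and symbols $\infty,\bar\infty$ ($\bar\infty<n<\infty$), with arbitrarily many trailing $\bar\infty$ understood, ordered componentwise; a box of a skew shape $\beta/\alpha$ lies in row $i$, column $j$ with $\alpha_i<j\leq\beta_i$. A stable horizontal strip is a pair $\alpha\subseteq\beta$ such that with $\alpha_m$ the first finite part of $\alpha$ and $\beta_n$ the last finite part of $\beta$, $\alpha_{m-1}=\infty=\beta_m>\alpha_m\geq\beta_{m+1}\geq\cdots\geq\alpha_{n-1}\geq\beta_n>\alpha_n=\bar\infty=\beta_{n+1}$ (at most one box per column, with two half-infinite rows at either end). Stable tableaux are chains of stable shapes with stable horizontal strip differences; ordinary tableaux are chains of integer shapes with (ordinary) horizontal strip differences ($\beta_i\geq\alpha_i\geq\beta_{i+1}$). The stable complement of $T:\beta^0\subseteq\cdots\subseteq\beta^k$ is $T^S:\beta^k\subseteq(\infty,\beta^{k-1})\subseteq\cdots\subseteq(\infty^k,\beta^0)$, with $(\infty^i,\gamma)$ denoting $\gamma$ with $i$ parts $\infty$ prepended; tableaux differing by vertical shift are identified. Internal column insertion $\mathcal{C}$ is the operation on pairs of tableaux sharing an inner (resp. outer) border computed by writing them along the first row and first column (resp. last row and last column) of a growth diagram and filling in with the local rule $\delta=\mathcal{C}(\alpha;\beta,\gamma)$: $d_m=0$; for $i=m,\dots,2$: $\delta_i=\min\{\beta_i+\gamma_i+d_i-\alpha_i,\alpha_{i-1}\}$, $d_{i-1}=\max\{\beta_i+\gamma_i+d_i-\alpha_i-\alpha_{i-1},0\}$;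 $\delta_1=\beta_1+\gamma_1+d_1-\alpha_1$ (resp. its unique inverse), returning the opposite row and column. Hopscotch: for a tableau $P$ and a stable tableau $Q$, one extending the other, $\mathcal{H}(P;Q):=(T;U^S)$ where $\mathcal{C}(P,Q^S)=(T,U)$. *)

theory Defs
  imports Complex_Main "HOL-Library.Extended"
begin

text \<open>
  A sequence with arbitrarily many trailing \<^const>\<open>Minf\<close> understood is a function on
  \<^typ>\<open>nat\<close>. Rows are numbered from 0. Containment of shapes is the pointwise order on functions.
\<close>

type_synonym shape = "nat \<Rightarrow> int extended"

definition stable_shape :: "shape \<Rightarrow> bool" where
  "stable_shape \<alpha> \<longleftrightarrow> antimono \<alpha> \<and> (\<exists>N. \<forall>i\<ge>N. \<alpha> i = Minf)"

definition prepend :: "nat \<Rightarrow> shape \<Rightarrow> shape" where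
  "prepend k \<gamma> = (\<lambda>i. if i < k then Pinf else \<gamma> (i - k))"

definition boxes :: "shape \<Rightarrow> shape \<Rightarrow> (nat \<times> int) set" where
  "boxes \<alpha> \<beta> = {(i, j). \<alpha> i < Fin j \<and> Fin j \<le> \<beta> i}"

definition box_columns :: "shape \<Rightarrow> shape \<Rightarrow> int set" where
  "box_columns \<alpha> \<beta> = snd ` boxes \<alpha> \<beta>"

definition one_box :: "shape \<Rightarrow> shape \<Rightarrow> int \<Rightarrow> bool" where
  "one_box \<alpha> \<beta> c \<longleftrightarrow> \<alpha> < \<beta> \<and> (\<exists>r. boxes \<alpha> \<beta> = {(r, c)})"

definition is_finite_part :: "int extended \<Rightarrow> bool" where
  "is_finite_part x \<longleftrightarrow> x \<in> range Fin"

definition first_finite :: "shape \<Rightarrow> nat \<Rightarrow> bool" where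
  "first_finite \<alpha> m \<longleftrightarrow> is_finite_part (\<alpha> m) \<and> (\<forall>i<m. \<not> is_finite_part (\<alpha> i))"

definition last_finite :: "shape \<Rightarrow> nat \<Rightarrow> bool" where
  "last_finite \<beta> n \<longleftrightarrow> is_finite_part (\<beta> n) \<and> (\<forall>i>n. \<not> is_finite_part (\<beta> i))"

text \<open>
  The condition on row \<open>m - 1\<close> is void when \<open>m\<close> is the top row.
\<close>

definition stable_hstrip :: "shape \<Rightarrow> shape \<Rightarrow> bool" where
  "stable_hstrip \<alpha> \<beta> \<longleftrightarrow>
     stable_shape \<alpha> \<and> stable_shape \<beta> \<and> \<alpha> \<le> \<beta> \<and>
     (\<exists>m n. first_finite \<alpha> m \<and> last_finite \<beta> n \<and>
        (0 < m \<longrightarrow> \<alpha> (m - 1) = Pinf) \<and> \<beta> m = Pinf \<and> \<beta> m > \<alpha> m \<and>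
        (\<forall>i. m \<le> i \<and> i < n \<longrightarrow> \<alpha> i \<ge> \<beta> (i + 1)) \<and>
        (\<forall>i. m < i \<and> i < n \<longrightarrow> \<beta> i \<ge> \<alpha> i) \<and>
        \<beta> n > \<alpha> n \<and> \<alpha> n = Minf \<and> \<beta> (n + 1) = Minf)"

text \<open>
  Tableaux are represented by their chains of shapes. Up to vertical shift, an integer shape
  with \<open>m\<close> parts is a stable shape consisting of \<open>p\<close> parts \<^const>\<open>Pinf\<close>, then \<open>m\<close> integers,
  then \<^const>\<open>Minf\<close>. The shapes of an ordinary tableau have the same \<open>p\<close> and \<open>m\<close>.
\<close>

definition integer_shape :: "nat \<Rightarrow> nat \<Rightarrow> shape \<Rightarrow> bool" where
  "integer_shape p m \<alpha> \<longleftrightarrow> antimono \<alpha> \<and> (\<forall>i<p. \<alpha> i = Pinf) \<and>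
     (\<forall>i. p \<le> i \<and> i < p + m \<longrightarrow> is_finite_part (\<alpha> i)) \<and> (\<forall>i\<ge>p + m. \<alpha> i = Minf)"

definition hstrip :: "shape \<Rightarrow> shape \<Rightarrow> bool" where
  "hstrip \<alpha> \<beta> \<longleftrightarrow> (\<forall>i. \<beta> i \<ge> \<alpha> i \<and> \<alpha> i \<ge> \<beta> (i + 1))"

definition tableau :: "shape list \<Rightarrow> bool" where
  "tableau P \<longleftrightarrow> P \<noteq> [] \<and> (\<exists>p m. \<forall>\<alpha>\<in>set P. integer_shape p m \<alpha>) \<and> successively hstrip P"

definition stable_tableau :: "shape list \<Rightarrow> bool" where
  "stable_tableau Q \<longleftrightarrow> Q \<noteq> [] \<and> (\<forall>\<alpha>\<in>set Q. stable_shape \<alpha>) \<and> successively stable_hstrip Q"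

definition vshift :: "nat \<Rightarrow> shape list \<Rightarrow> shape list" where
  "vshift k T = map (prepend k) T"

definition vshift_eq :: "shape list \<Rightarrow> shape list \<Rightarrow> bool" (infix \<open>\<simeq>\<close> 50) where
  "T \<simeq> T' \<longleftrightarrow> (\<exists>k l. vshift k T = vshift l T')"

definition stable_complement :: "shape list \<Rightarrow> shape list" where
  "stable_complement T = map (\<lambda>i. prepend i (T ! (length T - 1 - i))) [0..<length T]"

text \<open>
  The local rule for integer sequences with \<open>m\<close> parts, indexed by \<open>0, \<dots>, m - 1\<close>;
  \<open>col_carry m a b c i\<close> is the quantity \<open>d\<close> with index \<open>i\<close>.
\<close>

function col_carry ::
  "nat \<Rightarrow> (nat \<Rightarrow> int) \<Rightarrow> (nat \<Rightarrow> int) \<Rightarrow> (nat \<Rightarrow> int) \<Rightarrow> nat \<Rightarrow> int" where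
  "col_carry m a b c i =
     (if i + 1 < m
      then max (b (i + 1) + c (i + 1) + col_carry m a b c (i + 1) - a (i + 1) - a i) 0
      else 0)"
  by auto
termination by (relation "measure (\<lambda>(m, a, b, c, i). m - i)") auto

declare col_carry.simps [simp del]

definition col_rule_int ::
  "nat \<Rightarrow> (nat \<Rightarrow> int) \<Rightarrow> (nat \<Rightarrow> int) \<Rightarrow> (nat \<Rightarrow> int) \<Rightarrow> nat \<Rightarrow> int" where
  "col_rule_int m a b c i =
     (let s = b i + c i + col_carry m a b c i - a i
      in if i = 0 then s else min s (a (i - 1)))"

definition num_inf :: "shape \<Rightarrow> nat" where
  "num_inf \<alpha> = card {i. \<alpha> i = Pinf}"

definition num_fin :: "shape \<Rightarrow> nat" where
  "num_fin \<alpha> = card {i. is_finite_part (\<alpha> i)}"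

definition int_part :: "nat \<Rightarrow> shape \<Rightarrow> nat \<Rightarrow> int" where
  "int_part p \<alpha> i = (THE x. \<alpha> (p + i) = Fin x)"

text \<open>
  The local rule for vertically shifted integer shapes, all with the same rows of integers;
  these rows are read off from \<open>\<alpha>\<close>.
\<close>

definition col_rule :: "shape \<Rightarrow> shape \<Rightarrow> shape \<Rightarrow> shape" where
  "col_rule \<alpha> \<beta> \<gamma> =
     (let p = num_inf \<alpha>; m = num_fin \<alpha>
      in (\<lambda>i. if i < p then Pinf
              else if i < p + m
              then Fin (col_rule_int m (int_part p \<alpha>) (int_part p \<beta>) (int_part p \<gamma>) (i - p))
              else Minf))"

text \<open>
  \<open>growth P Q i j\<close> is the shape in row \<open>i\<close> and column \<open>j\<close> of the growth diagram with \<open>P\<close> along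
  the first row and \<open>Q\<close> along the first column.
\<close>

fun growth :: "shape list \<Rightarrow> shape list \<Rightarrow> nat \<Rightarrow> nat \<Rightarrow> shape" where
  "growth P Q 0 j = P ! j"
| "growth P Q (Suc i) 0 = Q ! Suc i"
| "growth P Q (Suc i) (Suc j) =
     col_rule (growth P Q i j) (growth P Q i (Suc j)) (growth P Q (Suc i) j)"

definition col_insert_inner :: "shape list \<Rightarrow> shape list \<Rightarrow> shape list \<times> shape list" where
  "col_insert_inner P Q =
     (map (\<lambda>j. growth P Q (length Q - 1) j) [0..<length P],
      map (\<lambda>i. growth P Q i (length P - 1)) [0..<length Q])"

definition col_insert_outer :: "shape list \<Rightarrow> shape list \<Rightarrow> shape list \<times> shape list" where
  "col_insert_outer P Q =
     (THE (T, U). tableau T \<and> tableau U \<and> hd T = hd U \<and> col_insert_inner T U = (P, Q))"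

text \<open>
  If \<open>P\<close> extends \<open>Q\<close>, then \<open>P\<close> and the stable complement of \<open>Q\<close> share their inner border.
  If \<open>Q\<close> extends \<open>P\<close>, they share their outer border after \<open>P\<close> is shifted down by the
  number of steps of \<open>Q\<close>.
\<close>

definition hopscotch :: "shape list \<Rightarrow> shape list \<Rightarrow> shape list \<times> shape list" where
  "hopscotch P Q =
     (if tableau P \<and> stable_tableau Q \<and> hd P = last Q then
        (let (T, U) = col_insert_inner P (stable_complement Q)
         in (T, stable_complement U))
      else if tableau P \<and> stable_tableau Q \<and> last P = hd Q then
        (let (T, U) = col_insert_outer (vshift (length Q - 1) P) (stable_complement Q)
         in (T, stable_complement U))
      else undefined)"

text \<open>
  The results of \<^const>\<open>hopscotch\<close> are significant up to vertical shift only.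
\<close>

definition hopscotch_eq ::
  "shape list \<Rightarrow> shape list \<Rightarrow> shape list \<Rightarrow> shape list \<Rightarrow> bool" where
  "hopscotch_eq P Q T U \<longleftrightarrow> fst (hopscotch P Q) \<simeq> T \<and> snd (hopscotch P Q) \<simeq> U"

definition hopscotch_shape :: "shape \<Rightarrow> shape \<Rightarrow> shape \<Rightarrow> shape" where
  "hopscotch_shape \<alpha> \<beta> \<delta> = (THE \<gamma>. hopscotch_eq [\<beta>, \<delta>] [\<alpha>, \<beta>] [\<alpha>, \<gamma>] [\<gamma>, \<delta>])"

definition hop_column :: "int set \<Rightarrow> int \<Rightarrow> int \<Rightarrow> bool" where
  "hop_column H c c' \<longleftrightarrow>
     (if c \<in> H then c' = c else c' \<in> H \<and> c < c' \<and> (\<forall>h\<in>H. c < h \<longrightarrow> c' \<le> h))"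

definition hop_cover :: "shape \<Rightarrow> shape \<Rightarrow> int \<Rightarrow> shape \<Rightarrow> bool" where
  "hop_cover \<alpha> \<beta> c \<gamma> \<longleftrightarrow>
     stable_shape \<gamma> \<and> (\<exists>c'. hop_column (box_columns \<alpha> \<beta>) c c' \<and> one_box \<alpha> \<gamma> c')"

end

theory Submission
  imports Defs
begin

text \<open>
  A stable horizontal strip \<open>\<beta>/\<alpha>\<close> amounts to integers \<open>a\<^sub>0 \<ge> b\<^sub>0 \<ge> a\<^sub>1 \<ge> b\<^sub>1 \<ge> \<dots>\<close>, where \<open>\<beta>\<close> has one more
  infinite part than \<open>\<alpha>\<close>; the columns without a box are those in the gaps \<open>(b\<^sub>i, a\<^sub>i]\<close>. The
  shapes \<open>\<beta>\<close>, \<open>\<delta>\<close> and \<open>(\<infinity>, \<alpha>)\<close> have their integers in the same rows, and hopscotch is a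
  single application of the local rule to them. If \<open>\<delta>/\<beta>\<close> lies in row \<open>t\<close>, the
  carry is 1 along the rows above \<open>t\<close> as long as \<open>a\<^sub>i = b\<^sub>i\<^sub>-\<^sub>1\<close>, and it stops in the first row \<open>s\<close>
  with \<open>s = 0\<close> or \<open>a\<^sub>s < b\<^sub>s\<^sub>-\<^sub>1\<close>, where it increases \<open>a\<^sub>s\<close> by 1. The equalities
  say that the gaps \<open>t, \<dots>, s\<close> are adjacent, so \<open>a\<^sub>s + 1\<close> is the first column after them that
  contains a box.
\<close>

section \<open>Shapes with a block of integers\<close>

definition int_shape :: "nat \<Rightarrow> nat \<Rightarrow> (nat \<Rightarrow> int) \<Rightarrow> shape" where
  "int_shape p k f = (\<lambda>i. if i < p then Pinf else if i < p + k then Fin (f (i - p)) else Minf)"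

text \<open>Index \<open>i\<close> stands for row \<open>m + i\<close> of \<alpha> and row
  \<open>Suc m + i\<close> of \<beta>. With this offset the first inequality allows at most one box
  per column, and the second amounts to \<alpha> \<le> \<beta>.\<close>

definition interlace :: "nat \<Rightarrow> (nat \<Rightarrow> int) \<Rightarrow> (nat \<Rightarrow> int) \<Rightarrow> bool" where
  "interlace k a b \<longleftrightarrow> (\<forall>i<k. b i \<le> a i) \<and> (\<forall>i. Suc i < k \<longrightarrow> a (Suc i) \<le> b i)"

lemma is_finite_part_simps [simp]:
  "is_finite_part (Fin x)" "\<not> is_finite_part Pinf" "\<not> is_finite_part Minf"
  by (auto simp: is_finite_part_def)

lemma int_shape_cong:
  "(\<And>i. i < k \<Longrightarrow> f i = g i) \<Longrightarrow> int_shape p k f = int_shape p k g"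
  by (auto simp: int_shape_def fun_eq_iff)

lemma int_shape_nth [simp]: "i < k \<Longrightarrow> int_shape p k f (p + i) = Fin (f i)"
  by (simp add: int_shape_def)

lemma prepend_int_shape: "prepend l (int_shape p k f) = int_shape (l + p) k f"
  by (auto simp: prepend_def int_shape_def fun_eq_iff)

lemma prepend_inject [simp]: "prepend l \<gamma> = prepend l \<gamma>' \<longleftrightarrow> \<gamma> = \<gamma>'"
proof
  assume "prepend l \<gamma> = prepend l \<gamma>'"
  then have "prepend l \<gamma> (i + l) = prepend l \<gamma>' (i + l)" for i
    by simp
  then show "\<gamma> = \<gamma>'"
    by (auto simp: prepend_def fun_eq_iff)
qed simp

lemma prepend_Suc: "prepend (Suc l) \<gamma> = prepend l (prepend 1 \<gamma>)"
  by (auto simp: prepend_def fun_eq_iff)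

lemma num_inf_int_shape [simp]: "num_inf (int_shape p k f) = p"
proof -
  have "{i. int_shape p k f i = Pinf} = {..<p}"
    by (auto simp: int_shape_def)
  then show ?thesis
    by (simp add: num_inf_def)
qed

lemma num_fin_int_shape [simp]: "num_fin (int_shape p k f) = k"
proof -
  have "{i. is_finite_part (int_shape p k f i)} = {p..<p + k}"
    by (auto simp: int_shape_def)
  then show ?thesis
    by (simp add: num_fin_def)
qed

lemma int_shape_eq_padD: "int_shape p k f = int_shape p' k' f' \<Longrightarrow> p = p'"
  by (metis num_inf_int_shape)

lemma antimono_int_shape_iff:
  "antimono (int_shape p k f) \<longleftrightarrow> (\<forall>i j. i \<le> j \<longrightarrow> j < k \<longrightarrow> f j \<le> f i)"
proof
  assume anti: "antimono (int_shape p k f)"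
  show "\<forall>i j. i \<le> j \<longrightarrow> j < k \<longrightarrow> f j \<le> f i"
  proof (intro allI impI)
    fix i j assume "i \<le> j" "j < k"
    then show "f j \<le> f i"
      using antimonoD[OF anti, of "p + i" "p + j"] by simp
  qed
next
  assume "\<forall>i j. i \<le> j \<longrightarrow> j < k \<longrightarrow> f j \<le> f i"
  then show "antimono (int_shape p k f)"
    by (auto simp: int_shape_def antimono_def)
qed

lemma stable_shape_int_shape_iff:
  "stable_shape (int_shape p k f) \<longleftrightarrow> (\<forall>i j. i \<le> j \<longrightarrow> j < k \<longrightarrow> f j \<le> f i)"
proof -
  have "\<forall>i\<ge>p + k. int_shape p k f i = Minf"
    by (simp add: int_shape_def)
  then show ?thesis
    unfolding stable_shape_def antimono_int_shape_iff by blast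
qed

lemma integer_shape_int_shape:
  "stable_shape (int_shape p k f) \<Longrightarrow> integer_shape p k (int_shape p k f)"
  by (auto simp: integer_shape_def stable_shape_def int_shape_def)

section \<open>Stable horizontal strips as interlacing sequences\<close>

lemma interlaceD:
  assumes "interlace k a b"
  shows "i < k \<Longrightarrow> b i \<le> a i" and "Suc i < k \<Longrightarrow> a (Suc i) \<le> b i"
  using assms by (auto simp: interlace_def)

lemma interlace_antimono:
  assumes "interlace k a b" "i \<le> j" "j < k"
  shows "a j \<le> a i" and "b j \<le> b i"
proof -
  have "a j \<le> a i \<and> b j \<le> b i"
    using assms(2,3)
  proof (induction j rule: dec_induct)
    case (step j)
    then show ?case
      using interlaceD[OF assms(1), of j] interlaceD[OF assms(1), of "Suc j"] by fastforce
  qed simp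
  then show "a j \<le> a i" "b j \<le> b i" by auto
qed

lemma interlace_stable_shape:
  assumes "interlace k a b"
  shows "stable_shape (int_shape p k a)" and "stable_shape (int_shape p k b)"
  using interlace_antimono[OF assms] by (auto simp: stable_shape_int_shape_iff)

lemma stable_hstrip_int_shapeI:
  assumes k: "0 < k" and ab: "interlace k a b"
  shows "stable_hstrip (int_shape m k a) (int_shape (Suc m) k b)"
proof -
  let ?\<alpha> = "int_shape m k a" and ?\<beta> = "int_shape (Suc m) k b"
  have le: "?\<alpha> \<le> ?\<beta>"
  proof (rule le_funI)
    fix i
    show "?\<alpha> i \<le> ?\<beta> i"
      using interlaceD(2)[OF ab, of "i - Suc m"]
      by (auto simp: int_shape_def Suc_diff_Suc)
  qed
  have ge: "?\<beta> (i + 1) \<le> ?\<alpha> i" for i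
    using interlaceD(1)[OF ab, of "i - m"] by (auto simp: int_shape_def)
  have ff: "first_finite ?\<alpha> m" and lf: "last_finite ?\<beta> (m + k)"
    using k by (auto simp: first_finite_def last_finite_def int_shape_def)
  have "0 < m \<longrightarrow> ?\<alpha> (m - 1) = Pinf" "?\<beta> m = Pinf" "?\<alpha> m < ?\<beta> m"
    "?\<alpha> (m + k) < ?\<beta> (m + k)" "?\<alpha> (m + k) = Minf" "?\<beta> (m + k + 1) = Minf"
    using k by (auto simp: int_shape_def)
  with le ge ff lf interlace_stable_shape[OF ab] show ?thesis
    unfolding stable_hstrip_def le_fun_def by blast
qed

text \<open>Finiteness comes from squeezing: in rows \<open>m\<close> to \<open>n - 1\<close> every
  part of \<alpha> lies between the last finite part of \<beta> and the first finite part of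
  \<alpha>, and so does the part of \<beta> one row below. In the other rows monotonicity propagates
  the infinite values.\<close>

lemma stable_hstrip_int_shapeE:
  assumes "stable_hstrip \<alpha> \<beta>"
  obtains m k a b where "0 < k" "interlace k a b"
    "\<alpha> = int_shape m k a" "\<beta> = int_shape (Suc m) k b"
proof -
  have anti: "antimono \<alpha>" "antimono \<beta>" and le: "\<alpha> \<le> \<beta>"
    using assms by (simp_all add: stable_hstrip_def stable_shape_def)
  obtain m n where ff: "first_finite \<alpha> m" and lf: "last_finite \<beta> n"
    and top: "0 < m \<longrightarrow> \<alpha> (m - 1) = Pinf" "\<beta> m = Pinf"
    and ge': "\<forall>i. m \<le> i \<and> i < n \<longrightarrow> \<beta> (i + 1) \<le> \<alpha> i"
    and bot: "\<alpha> n = Minf" "\<beta> (n + 1) = Minf"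
    using assms unfolding stable_hstrip_def by metis
  have ge: "\<beta> (i + 1) \<le> \<alpha> i" if "m \<le> i" "i < n" for i
    using ge' that by blast
  obtain x where x: "\<alpha> m = Fin x"
    using ff by (auto simp: first_finite_def is_finite_part_def)
  obtain y where y: "\<beta> n = Fin y"
    using lf by (auto simp: last_finite_def is_finite_part_def)
  have mn: "m < n"
    using antimonoD[OF anti(2), of n m] top(2) y by (cases "n \<le> m") auto
  define k where "k = n - m"
  have n: "n = m + k" and k: "0 < k"
    using mn by (auto simp: k_def)
  have \<alpha>fin: "\<exists>z. \<alpha> (m + i) = Fin z" if "i < k" for i
  proof -
    have "\<alpha> (m + i) \<le> Fin x"
      using antimonoD[OF anti(1), of m "m + i"] x by simp
    moreover have "Fin y \<le> \<beta> (m + i + 1)"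
      using antimonoD[OF anti(2), of "m + i + 1" n] y that n by simp
    then have "Fin y \<le> \<alpha> (m + i)"
      using ge[of "m + i"] that n by (meson le_add1 nat_add_left_cancel_less order_trans)
    ultimately show ?thesis
      by (cases "\<alpha> (m + i)") auto
  qed
  then obtain a where a: "\<And>i. i < k \<Longrightarrow> \<alpha> (m + i) = Fin (a i)"
    by metis
  have \<beta>fin: "\<exists>z. \<beta> (Suc m + i) = Fin z" if "i < k" for i
  proof -
    have "Fin y \<le> \<beta> (m + i + 1)"
      using antimonoD[OF anti(2), of "m + i + 1" n] y that n by simp
    moreover have "\<beta> (m + i + 1) \<le> Fin (a i)"
      using ge[of "m + i"] that n a[of i] by simp
    ultimately show ?thesis
      by (cases "\<beta> (m + i + 1)") auto
  qed
  then obtain b where b: "\<And>i. i < k \<Longrightarrow> \<beta> (Suc m + i) = Fin (b i)"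
    by metis
  have \<alpha>: "\<alpha> = int_shape m k a"
  proof
    fix i
    consider "i < m" | "m \<le> i" "i < m + k" | "m + k \<le> i" by linarith
    then show "\<alpha> i = int_shape m k a i"
    proof cases
      case 1
      then have "\<alpha> (m - 1) \<le> \<alpha> i"
        by (intro antimonoD[OF anti(1)]) simp
      with 1 top show ?thesis
        by (cases "\<alpha> i") (auto simp: int_shape_def)
    next
      case 2
      then show ?thesis
        using a[of "i - m"] by (simp add: int_shape_def)
    next
      case 3
      then have "\<alpha> i \<le> \<alpha> n"
        using n by (intro antimonoD[OF anti(1)]) simp
      with 3 bot show ?thesis
        by (cases "\<alpha> i") (auto simp: int_shape_def)
    qed
  qed
  have \<beta>: "\<beta> = int_shape (Suc m) k b"
  proof
    fix i
    consider "i \<le> m" | "Suc m \<le> i" "i < Suc m + k" | "Suc m + k \<le> i" by linarith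
    then show "\<beta> i = int_shape (Suc m) k b i"
    proof cases
      case 1
      then have "\<beta> m \<le> \<beta> i"
        by (intro antimonoD[OF anti(2)])
      with 1 top show ?thesis
        by (cases "\<beta> i") (auto simp: int_shape_def)
    next
      case 2
      then show ?thesis
        using b[of "i - Suc m"] by (simp add: int_shape_def)
    next
      case 3
      then have "\<beta> i \<le> \<beta> (n + 1)"
        using n by (intro antimonoD[OF anti(2)]) simp
      with 3 bot show ?thesis
        by (cases "\<beta> i") (auto simp: int_shape_def)
    qed
  qed
  have "b i \<le> a i" if "i < k" for i
    using ge[of "m + i"] that n a[of i] b[of i] by simp
  moreover have "a (Suc i) \<le> b i" if "Suc i < k" for i
    using le_funD[OF le, of "Suc m + i"] that a[of "Suc i"] b[of i] by simp
  ultimately have "interlace k a b"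
    by (simp add: interlace_def)
  with k \<alpha> \<beta> show thesis
    by (intro that)
qed

section \<open>Adding a single box\<close>

lemma eq_if_no_box:
  assumes "x \<le> y" "\<And>j. \<not> (x < Fin j \<and> Fin j \<le> y)"
  shows "x = (y :: int extended)"
proof (cases x)
  case (Fin u)
  then show ?thesis
    using assms(1) assms(2)[of "u + 1"] by (cases y) auto
next
  case Minf
  then show ?thesis
    using assms(2) by (cases y) auto
qed (use assms(1) in \<open>cases y; auto\<close>)

lemma one_box_int_shapeE:
  assumes "one_box (int_shape p k f) \<gamma> c" "stable_shape \<gamma>"
  obtains t where "t < k" "c = f t + 1" "\<gamma> = int_shape p k (f(t := f t + 1))"
    "\<And>i. i < t \<Longrightarrow> f t < f i"
proof -
  let ?\<alpha> = "int_shape p k f"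
  obtain r where le: "?\<alpha> \<le> \<gamma>" and boxes: "boxes ?\<alpha> \<gamma> = {(r, c)}"
    using assms(1) by (auto simp: one_box_def)
  have box: "?\<alpha> i < Fin j \<and> Fin j \<le> \<gamma> i \<longleftrightarrow> i = r \<and> j = c" for i j
    using boxes by (auto simp: boxes_def)
  have r: "?\<alpha> r < Fin c" "Fin c \<le> \<gamma> r"
    using box by auto
  \<comment> \<open>In a row with value \<open>Minf\<close> the box of column \<open>c\<close> would
    bring the box of column \<open>c - 1\<close> with it.\<close>
  have "?\<alpha> r \<noteq> Minf"
    using box[of r "c - 1"] r by (cases "\<gamma> r") auto
  then have rb: "p \<le> r" "r < p + k"
    using r by (auto simp: int_shape_def split: if_splits)
  define t where "t = r - p"
  have t: "t < k" "r = p + t"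
    using rb by (auto simp: t_def)
  have \<alpha>r: "?\<alpha> r = Fin (f t)"
    using t by simp
  \<comment> \<open>The boxes of a row are consecutive from column \<open>f t + 1\<close> on, so a
    single box sits there and \<open>\<gamma> r\<close> cannot exceed it.\<close>
  have c: "c = f t + 1"
    using box[of r "f t + 1"] r \<alpha>r by (cases "\<gamma> r") auto
  have \<gamma>r: "\<gamma> r = Fin c"
    using box[of r "c + 1"] r \<alpha>r by (cases "\<gamma> r") auto
  have "\<gamma> i = ?\<alpha> i" if "i \<noteq> r" for i
    using eq_if_no_box[OF le_funD[OF le, of i]] box[of i] that by auto
  then have \<gamma>: "\<gamma> = int_shape p k (f(t := f t + 1))"
    using t \<gamma>r c by (auto simp: int_shape_def fun_eq_iff)
  have "f t < f i" if "i < t" for i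
    using assms(2)[unfolded \<gamma> stable_shape_int_shape_iff, rule_format, of i t] that t by simp
  with t c \<gamma> show thesis
    by (intro that)
qed

lemma one_box_int_shapeI:
  assumes "t < k"
  shows "one_box (int_shape p k f) (int_shape p k (f(t := f t + 1))) (f t + 1)"
proof -
  let ?\<alpha> = "int_shape p k f" and ?\<gamma> = "int_shape p k (f(t := f t + 1))"
  have "?\<alpha> \<le> ?\<gamma>"
    by (rule le_funI) (auto simp: int_shape_def)
  moreover have "?\<alpha> (p + t) \<noteq> ?\<gamma> (p + t)"
    using assms by simp
  then have "?\<alpha> \<noteq> ?\<gamma>"
    by metis
  moreover have "boxes ?\<alpha> ?\<gamma> = {(p + t, f t + 1)}"
    using assms by (auto simp: boxes_def int_shape_def split: if_splits)
  ultimately show ?thesis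
    unfolding one_box_def by (auto simp: less_le)
qed

section \<open>The local rule on integer blocks\<close>

lemma col_carry_cong:
  assumes "\<And>i. i < k \<Longrightarrow> a i = a' i" "\<And>i. i < k \<Longrightarrow> b i = b' i" "\<And>i. i < k \<Longrightarrow> c i = c' i"
  shows "col_carry k a b c i = col_carry k a' b' c' i"
proof (induction "k - i" arbitrary: i rule: less_induct)
  case less
  then show ?case
    using assms by (subst (1 2) col_carry.simps) auto
qed

lemma col_rule_int_cong:
  assumes "\<And>i. i < k \<Longrightarrow> a i = a' i" "\<And>i. i < k \<Longrightarrow> b i = b' i" "\<And>i. i < k \<Longrightarrow> c i = c' i"
    and "i < k"
  shows "col_rule_int k a b c i = col_rule_int k a' b' c' i"
  using assms col_carry_cong[of k a a' b b' c c' i] by (cases i) (simp_all add: col_rule_int_def)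

lemma int_part_int_shape [simp]: "i < k \<Longrightarrow> int_part p (int_shape p k f) i = f i"
  by (simp add: int_part_def)

text \<open>Outside the block \<open>int_part\<close> is unspecified, hence the detour through
  \<open>col_rule_int_cong\<close>.\<close>

lemma col_rule_int_shape:
  "col_rule (int_shape p k a) (int_shape p k b) (int_shape p k c)
     = int_shape p k (col_rule_int k a b c)"
proof -
  have "col_rule_int k (int_part p (int_shape p k a)) (int_part p (int_shape p k b))
      (int_part p (int_shape p k c)) i = col_rule_int k a b c i" if "i < k" for i
    using that by (intro col_rule_int_cong) auto
  then show ?thesis
    by (auto simp: col_rule_def Let_def int_shape_def[of p k "col_rule_int k a b c"] fun_eq_iff)
qed

section \<open>Propagation of the carry\<close>

text \<open>
  Row \<open>s\<close> is where the carry started by the box added to row \<open>t\<close> comes to rest.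
\<close>

definition carry_stop :: "(nat \<Rightarrow> int) \<Rightarrow> (nat \<Rightarrow> int) \<Rightarrow> nat \<Rightarrow> nat \<Rightarrow> bool" where
  "carry_stop a b t s \<longleftrightarrow> s \<le> t \<and> (0 < s \<longrightarrow> a s < b (s - 1)) \<and>
     (\<forall>i. s \<le> i \<and> i < t \<longrightarrow> a (Suc i) = b i)"

text \<open>Move up from row \<open>t\<close> while the compared entries agree; interlacing turns
  the first disagreement into a strict inequality, and the top row ends the search.\<close>

lemma carry_stop_exists:
  assumes "interlace k a b" "t < k"
  shows "\<exists>s. carry_stop a b t s"
  using assms(2)
proof (induction t)
  case 0
  show ?case
    by (auto simp: carry_stop_def)
next
  case (Suc t)
  show ?case
  proof (cases "a (Suc t) = b t")
    case True
    with Suc obtain s where "carry_stop a b t s" by auto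
    with True have "carry_stop a b (Suc t) s"
      by (auto simp: carry_stop_def less_Suc_eq)
    then show ?thesis ..
  next
    case False
    with interlaceD(2)[OF assms(1), of t] Suc.prems have "carry_stop a b (Suc t) (Suc t)"
      by (auto simp: carry_stop_def)
    then show ?thesis ..
  qed
qed

text \<open>The chain \<open>a s < b (s - 1) \<le> a (s - 1) \<le> a i\<close> shows that row
  \<open>s\<close> has room for a box.\<close>

lemma carry_stop_less:
  assumes ab: "interlace k a b" and st: "carry_stop a b t s" "t < k" and "i < s"
  shows "a s < a i"
proof -
  have "b (s - 1) \<le> a (s - 1)" "a (s - 1) \<le> a i"
    using assms interlaceD(1)[OF ab, of "s - 1"] interlace_antimono(1)[OF ab, of i "s - 1"]
    by (auto simp: carry_stop_def)
  with st \<open>i < s\<close> show ?thesis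
    by (auto simp: carry_stop_def)
qed

text \<open>This is the case of an empty gap \<open>t\<close>. A carry leaving row \<open>t\<close>
  would need \<open>a t = b (t - 1)\<close>, hence \<open>b t = b (t - 1)\<close>, against the
  addability of the box in row \<open>t\<close> of \<beta>.\<close>

lemma carry_stop_self:
  assumes ab: "interlace k a b" and st: "carry_stop a b t s" "t < k"
    and eq: "a t = b t" and bt: "\<And>i. i < t \<Longrightarrow> b t < b i"
  shows "s = t"
proof (rule ccontr)
  assume "s \<noteq> t"
  with st have "s \<le> t - 1" "t - 1 < t"
    by (auto simp: carry_stop_def)
  with st have "a t = b (t - 1)"
    by (auto simp: carry_stop_def dest!: spec[of _ "t - 1"])
  with eq bt[of "t - 1"] \<open>t - 1 < t\<close> show False
    by simp
qed

text \<open>After cancellation the carry at \<open>i\<close> is the positive part of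
  \<open>a (Suc i) - b i + u\<close>, where \<open>u\<close> is 1 if row \<open>Suc i\<close>
  contains the new box or receives a carry, and 0 otherwise. Since
  \<open>a (Suc i) \<le> b i\<close>, the unit passes on exactly under equality.\<close>

lemma col_carry_one_box:
  assumes ab: "interlace k a b" and st: "carry_stop a b t s" "t < k" and "i < k"
  shows "col_carry k b (b(t := b t + 1)) a i = (if s \<le> i \<and> i < t then 1 else 0)"
  using \<open>i < k\<close>
proof (induction "k - i" arbitrary: i rule: less_induct)
  case less
  show ?case
  proof (cases "Suc i < k")
    case True
    have IH: "col_carry k b (b(t := b t + 1)) a (Suc i) = (if s \<le> Suc i \<and> Suc i < t then 1 else 0)"
      using less True by auto
    have "a (Suc i) < b i" if "s \<le> Suc i" "\<not> s \<le> i"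
      using that st by (auto simp: carry_stop_def dest: le_antisym)
    moreover have "a (Suc i) = b i" if "s \<le> i" "i < t"
      using that st by (auto simp: carry_stop_def)
    moreover have "a (Suc i) \<le> b i"
      using interlaceD(2)[OF ab True] .
    moreover have "s \<le> t"
      using st by (simp add: carry_stop_def)
    ultimately show ?thesis
      using True by (subst col_carry.simps) (auto simp: IH)
  next
    case False
    with less st show ?thesis
      by (subst col_carry.simps) auto
  qed
qed

text \<open>A unit arrives in every row from \<open>t\<close> up to \<open>s\<close>. In the rows
  after \<open>s\<close> the bound \<open>b (i - 1) = a i\<close> cuts it off; at \<open>s\<close>
  the strict inequality, or the missing bound if \<open>s = 0\<close>, lets it through.\<close>

lemma col_rule_int_one_box:
  assumes ab: "interlace k a b" and st: "carry_stop a b t s" "t < k" and "i < k"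
  shows "col_rule_int k b (b(t := b t + 1)) a i = (a(s := a s + 1)) i"
proof (cases i)
  case 0
  then show ?thesis
    using st \<open>i < k\<close> by (auto simp: col_rule_int_def col_carry_one_box[OF ab st] carry_stop_def)
next
  case (Suc j)
  have "a i < b j" if "i = s"
    using that st Suc by (auto simp: carry_stop_def)
  moreover have "a i = b j" if "s \<le> j" "j < t"
    using that st Suc by (auto simp: carry_stop_def)
  moreover have "a i \<le> b j"
    using interlaceD(2)[OF ab] \<open>i < k\<close> Suc by simp
  moreover have "s \<le> t"
    using st by (simp add: carry_stop_def)
  ultimately show ?thesis
    using Suc \<open>i < k\<close> by (auto simp: col_rule_int_def col_carry_one_box[OF ab st])
qed

section \<open>Hopscotch as a single application of the local rule\<close>

text \<open>The growth diagram has one cell, with corner \<beta> and neighbours \<delta> and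
  \<open>prepend 1 \<alpha>\<close>. The results appear with one extra infinite part, a mere
  vertical shift.\<close>

lemma hopscotch_one_step:
  assumes "tableau [\<beta>, \<delta>]" "stable_tableau [\<alpha>, \<beta>]"
    and "col_rule \<beta> \<delta> (prepend 1 \<alpha>) = prepend 1 \<gamma>"
  shows "hopscotch [\<beta>, \<delta>] [\<alpha>, \<beta>] = ([prepend 1 \<alpha>, prepend 1 \<gamma>], [prepend 1 \<gamma>, prepend 1 \<delta>])"
proof -
  have [simp]: "prepend 0 \<gamma> = \<gamma>" for \<gamma>
    by (simp add: prepend_def)
  have "stable_complement [\<gamma>, \<gamma>'] = [\<gamma>', prepend 1 \<gamma>]" for \<gamma> \<gamma>'
    by (simp add: stable_complement_def upt_rec)
  then show ?thesis
    using assms by (simp add: hopscotch_def col_insert_inner_def upt_rec)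
qed

lemma vshift_eq_prepend_one: "[prepend 1 \<alpha>, prepend 1 \<gamma>] \<simeq> [\<alpha>, \<gamma>]"
proof -
  have "vshift 0 [prepend 1 \<alpha>, prepend 1 \<gamma>] = vshift 1 [\<alpha>, \<gamma>]"
    by (simp add: vshift_def prepend_def fun_eq_iff)
  then show ?thesis
    unfolding vshift_eq_def by blast
qed

text \<open>The number of infinite parts of \<alpha> fixes the relative shift, which then cancels
  from the second shapes. This makes the description in \<open>hopscotch_shape\<close>
  unique.\<close>

lemma vshift_eq_prepend_one_unique:
  assumes \<alpha>: "\<alpha> = int_shape p k a" and eq: "[prepend 1 \<alpha>, prepend 1 \<gamma>] \<simeq> [\<alpha>, \<gamma>']"
  shows "\<gamma>' = \<gamma>"
proof -
  obtain i j where ij: "prepend i (prepend 1 \<alpha>) = prepend j \<alpha>"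
      "prepend i (prepend 1 \<gamma>) = prepend j \<gamma>'"
    using eq by (auto simp: vshift_eq_def vshift_def)
  from ij(1) have "j = Suc i"
    unfolding \<alpha> prepend_int_shape by (auto dest: int_shape_eq_padD)
  with ij(2) have "prepend i (prepend 1 \<gamma>) = prepend i (prepend 1 \<gamma>')"
    by (simp only: prepend_Suc)
  then show ?thesis
    by simp
qed

section \<open>Columns without boxes and the target column\<close>

text \<open>Up to row \<open>m + i\<close> the parts of \<alpha> are at least \<open>a i\<close>, so
  column \<open>j\<close> is already filled; from the next row on the parts of \<beta> are at most
  \<open>b i\<close>, so it is not reached.\<close>

lemma box_columns_gap:
  assumes ab: "interlace k a b" and "i < k" "b i < j" "j \<le> a i"
  shows "j \<notin> box_columns (int_shape m k a) (int_shape (Suc m) k b)"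
proof
  assume "j \<in> box_columns (int_shape m k a) (int_shape (Suc m) k b)"
  then obtain r where r: "int_shape m k a r < Fin j" "Fin j \<le> int_shape (Suc m) k b r"
    by (auto simp: box_columns_def boxes_def)
  then have "m \<le> r"
    by (auto simp: int_shape_def split: if_splits)
  show False
  proof (cases "r \<le> m + i")
    case True
    then have "r - m \<le> i" by simp
    then show False
      using r \<open>m \<le> r\<close> interlace_antimono(1)[OF ab, of "r - m" i] assms
      by (auto simp: int_shape_def split: if_splits)
  next
    case False
    then have "i \<le> r - Suc m" by simp
    moreover have "r - Suc m < k"
      using r False by (auto simp: int_shape_def split: if_splits)
    ultimately show False
      using r \<open>m \<le> r\<close> interlace_antimono(2)[OF ab, of i "r - Suc m"] assms
      by (auto simp: int_shape_def split: if_splits)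
  qed
qed

text \<open>Row \<open>m + s\<close> of \<beta> ends at \<open>b (s - 1)\<close>, or is unbounded
  for \<open>s = 0\<close>; both exceed \<open>a s\<close>.\<close>

lemma box_columns_stop:
  assumes "carry_stop a b t s" "t < k"
  shows "a s + 1 \<in> box_columns (int_shape m k a) (int_shape (Suc m) k b)"
proof -
  have "(m + s, a s + 1) \<in> boxes (int_shape m k a) (int_shape (Suc m) k b)"
    using assms by (cases s) (auto simp: boxes_def int_shape_def carry_stop_def)
  then show ?thesis
    unfolding box_columns_def by force
qed

text \<open>The intervals \<open>(b i, a i]\<close> for \<open>i\<close> from \<open>t\<close> down
  to \<open>s\<close> are joined end to end by \<open>a (Suc i) = b i\<close>, and so fill
  \<open>(b t, a s]\<close>.\<close>

lemma carry_stop_gap: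
  assumes "carry_stop a b t s" "b t < j" "j \<le> a s"
  shows "\<exists>i\<le>t. b i < j \<and> j \<le> a i"
proof -
  have "\<exists>i\<le>t. b i < j \<and> j \<le> a i" if "s \<le> u" "u \<le> t" "b u < j" for u
    using that
  proof (induction u rule: dec_induct)
    case base
    then show ?case using assms(3) by blast
  next
    case (step u)
    show ?case
    proof (cases "j \<le> a (Suc u)")
      case False
      then have "b u < j"
        using assms(1) step by (auto simp: carry_stop_def)
      then show ?thesis using step by auto
    qed (use step in auto)
  qed
  then show ?thesis
    using assms by (auto simp: carry_stop_def)
qed

text \<open>If gap \<open>t\<close> is empty, the carry stays in row \<open>t\<close> and
  \<open>b t + 1\<close> itself contains a box of the strip. Otherwise all columns from
  \<open>b t + 1\<close> to \<open>a s\<close> lie in gaps.\<close>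

lemma hop_column_one_box:
  assumes ab: "interlace k a b" and st: "carry_stop a b t s" "t < k"
    and bt: "\<And>i. i < t \<Longrightarrow> b t < b i"
  shows "hop_column (box_columns (int_shape m k a) (int_shape (Suc m) k b)) (b t + 1) (a s + 1)"
proof -
  let ?H = "box_columns (int_shape m k a) (int_shape (Suc m) k b)"
  have stop: "a s + 1 \<in> ?H"
    using box_columns_stop[OF st] .
  have le: "b t \<le> a t" "a t \<le> a s"
    using interlaceD(1)[OF ab] interlace_antimono(1)[OF ab, of s t] st
    by (auto simp: carry_stop_def)
  show ?thesis
  proof (cases "a t = b t")
    case True
    then have "s = t"
      using carry_stop_self[OF ab st] bt by blast
    with stop True show ?thesis
      by (simp add: hop_column_def)
  next
    case False
    with le have "b t + 1 \<notin> ?H"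
      using box_columns_gap[OF ab, of t "b t + 1"] st by simp
    moreover have "a s + 1 \<le> h" if h: "h \<in> ?H" "b t + 1 < h" for h
    proof (rule ccontr)
      assume "\<not> a s + 1 \<le> h"
      then obtain i where "i \<le> t" "b i < h" "h \<le> a i"
        using carry_stop_gap[OF st(1), of h] h by auto
      with box_columns_gap[OF ab, of i h] h st show False
        by simp
    qed
    ultimately show ?thesis
      using stop le False by (auto simp: hop_column_def)
  qed
qed

lemma hop_column_unique: "hop_column H c d \<Longrightarrow> hop_column H c d' \<Longrightarrow> d = d'"
  by (auto simp: hop_column_def split: if_splits intro: antisym)

lemma hop_cover_int_shape_iff:
  assumes ab: "interlace k a b" and st: "carry_stop a b t s" "t < k"
    and bt: "\<And>i. i < t \<Longrightarrow> b t < b i"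
  shows "hop_cover (int_shape m k a) (int_shape (Suc m) k b) (b t + 1) \<gamma> \<longleftrightarrow>
    \<gamma> = int_shape m k (a(s := a s + 1))"
proof
  assume "hop_cover (int_shape m k a) (int_shape (Suc m) k b) (b t + 1) \<gamma>"
  then obtain c where "hop_column (box_columns (int_shape m k a) (int_shape (Suc m) k b)) (b t + 1) c"
    and c: "one_box (int_shape m k a) \<gamma> c" "stable_shape \<gamma>"
    by (auto simp: hop_cover_def)
  then have ceq: "c = a s + 1"
    using hop_column_unique hop_column_one_box[OF assms] by blast
  obtain u where u: "u < k" "c = a u + 1" "\<gamma> = int_shape m k (a(u := a u + 1))"
    "\<And>i. i < u \<Longrightarrow> a u < a i"
    using one_box_int_shapeE[OF c] by metis
  \<comment> \<open>Boxes addable in different rows have different columns: the upper of the rows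
    \<open>u\<close> and \<open>s\<close> would have the larger entry of \<open>a\<close>, whereas
    the columns give \<open>a u = a s\<close>.\<close>
  have "u = s"
    using u(2) u(4)[of s] ceq carry_stop_less[OF ab st, of u] by (cases u s rule: linorder_cases) auto
  with u show "\<gamma> = int_shape m k (a(s := a s + 1))"
    by simp
next
  assume \<gamma>: "\<gamma> = int_shape m k (a(s := a s + 1))"
  have "s < k"
    using st by (simp add: carry_stop_def)
  then have "one_box (int_shape m k a) \<gamma> (a s + 1)"
    unfolding \<gamma> by (rule one_box_int_shapeI)
  moreover have "(a(s := a s + 1)) j \<le> (a(s := a s + 1)) i" if "i \<le> j" "j < k" for i j
    using that interlace_antimono(1)[OF ab that] carry_stop_less[OF ab st, of i]
    by (auto simp: le_less)
  then have "stable_shape \<gamma>"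
    unfolding \<gamma> stable_shape_int_shape_iff by blast
  ultimately show "hop_cover (int_shape m k a) (int_shape (Suc m) k b) (b t + 1) \<gamma>"
    unfolding hop_cover_def using hop_column_one_box[OF assms] by blast
qed

section \<open>The strip and tableau conditions after adding the boxes\<close>

text \<open>Two inequalities are at risk. \<open>b t + 1 \<le> a t\<close> fails only if gap
  \<open>t\<close> is empty, but then \<open>s = t\<close> and \<open>a t\<close> grows too;
  \<open>a s + 1 \<le> b (s - 1)\<close> holds by the choice of \<open>s\<close>.\<close>

lemma interlace_one_box:
  assumes ab: "interlace k a b" and st: "carry_stop a b t s" "t < k"
    and bt: "\<And>i. i < t \<Longrightarrow> b t < b i"
  shows "interlace k (a(s := a s + 1)) (b(t := b t + 1))"
proof -
  have "b t + 1 \<le> (a(s := a s + 1)) t"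
    using carry_stop_self[OF ab st] bt interlaceD(1)[OF ab st(2)] by fastforce
  moreover have "a s + 1 \<le> b i" if "Suc i = s" for i
    using st that by (auto simp: carry_stop_def)
  ultimately show ?thesis
    using interlaceD[OF ab] by (fastforce simp: interlace_def)
qed

lemma tableau_one_box:
  assumes "stable_shape (int_shape p k f)" "stable_shape (int_shape p k (f(t := f t + 1)))"
    and "\<And>i. i < t \<Longrightarrow> f t < f i" and "t < k"
  shows "tableau [int_shape p k f, int_shape p k (f(t := f t + 1))]"
proof -
  let ?\<beta> = "int_shape p k f" and ?\<delta> = "int_shape p k (f(t := f t + 1))"
  have "?\<delta> (Suc i) \<le> ?\<beta> i" for i
  proof -
    have "f j \<le> f i" if "i \<le> j" "j < k" for i j
      using assms(1) that by (simp add: stable_shape_int_shape_iff)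
    then have "(f(t := f t + 1)) (Suc i - p) \<le> f (i - p)" if "p \<le> i" "Suc i < p + k"
      using that assms(3)[of "i - p"] by (auto simp: Suc_diff_le)
    then show ?thesis
      by (cases "p \<le> i") (auto simp: int_shape_def)
  qed
  then have "hstrip ?\<beta> ?\<delta>"
    by (auto simp: hstrip_def) (auto simp: int_shape_def)
  then show ?thesis
    using integer_shape_int_shape[OF assms(1)] integer_shape_int_shape[OF assms(2)]
    by (auto simp: tableau_def)
qed

theorem theorem6p3:
  fixes \<alpha> \<beta> \<delta> :: shape and c :: int
  assumes "stable_shape \<alpha>" and "stable_shape \<beta>" and "stable_shape \<delta>"
    and "\<alpha> < \<beta>" and "\<beta> < \<delta>"
    and "stable_hstrip \<alpha> \<beta>"
    and "one_box \<beta> \<delta> c"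
  shows "(\<exists>!\<gamma>. hop_cover \<alpha> \<beta> c \<gamma>) \<and>
    (\<forall>\<gamma>. hop_cover \<alpha> \<beta> c \<gamma> \<longrightarrow>
       \<gamma> < \<delta> \<and>
       stable_hstrip \<gamma> \<delta> \<and>
       hopscotch_eq [\<beta>, \<delta>] [\<alpha>, \<beta>] [\<alpha>, \<gamma>] [\<gamma>, \<delta>] \<and>
       \<gamma> = hopscotch_shape \<alpha> \<beta> \<delta>)"
proof -
  obtain m k a b where k: "0 < k" and ab: "interlace k a b"
    and \<alpha>: "\<alpha> = int_shape m k a" and \<beta>: "\<beta> = int_shape (Suc m) k b"
    using stable_hstrip_int_shapeE[OF assms(6)] by metis
  obtain t where t: "t < k" and c: "c = b t + 1"
    and \<delta>: "\<delta> = int_shape (Suc m) k (b(t := b t + 1))" and bt: "\<And>i. i < t \<Longrightarrow> b t < b i"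
    using one_box_int_shapeE[OF assms(7)[unfolded \<beta>] assms(3)] by metis
  obtain s where s: "carry_stop a b t s"
    using carry_stop_exists[OF ab t] by blast
  \<comment> \<open>The new box goes where the carry of the local rule comes to rest; the column
    rule singles out the same row.\<close>
  define \<gamma> where "\<gamma> = int_shape m k (a(s := a s + 1))"
  have cover: "hop_cover \<alpha> \<beta> c \<gamma>' \<longleftrightarrow> \<gamma>' = \<gamma>" for \<gamma>'
    unfolding \<alpha> \<beta> c \<gamma>_def using hop_cover_int_shape_iff[OF ab s t] bt by blast
  have strip: "stable_hstrip \<gamma> \<delta>"
    unfolding \<gamma>_def \<delta> using interlace_one_box[OF ab s t] bt
    by (blast intro: stable_hstrip_int_shapeI[OF k])
  then have "\<gamma> \<le> \<delta>"
    by (simp add: stable_hstrip_def)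
  \<comment> \<open>The two shapes have \<open>m\<close> and \<open>Suc m\<close> infinite
    parts.\<close>
  moreover have "\<gamma> \<noteq> \<delta>"
    unfolding \<gamma>_def \<delta> by (auto dest: int_shape_eq_padD)
  ultimately have less: "\<gamma> < \<delta>"
    by simp
  have "tableau [\<beta>, \<delta>]"
    using tableau_one_box[of "Suc m" k b t] assms(2,3) bt t by (simp add: \<beta> \<delta>)
  moreover have "stable_tableau [\<alpha>, \<beta>]"
    using assms by (simp add: stable_tableau_def)
  moreover have "col_rule \<beta> \<delta> (prepend 1 \<alpha>) = prepend 1 \<gamma>"
    unfolding \<alpha> \<beta> \<gamma>_def \<delta> prepend_int_shape plus_1_eq_Suc col_rule_int_shape
    by (rule int_shape_cong) (rule col_rule_int_one_box[OF ab s t])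
  ultimately have hop: "hopscotch [\<beta>, \<delta>] [\<alpha>, \<beta>] =
      ([prepend 1 \<alpha>, prepend 1 \<gamma>], [prepend 1 \<gamma>, prepend 1 \<delta>])"
    by (rule hopscotch_one_step)
  have heq: "hopscotch_eq [\<beta>, \<delta>] [\<alpha>, \<beta>] [\<alpha>, \<gamma>] [\<gamma>, \<delta>]"
    unfolding hopscotch_eq_def hop fst_conv snd_conv by (intro conjI vshift_eq_prepend_one)
  have "hopscotch_shape \<alpha> \<beta> \<delta> = \<gamma>"
    unfolding hopscotch_shape_def
  proof (rule the_equality)
    show "hopscotch_eq [\<beta>, \<delta>] [\<alpha>, \<beta>] [\<alpha>, \<gamma>] [\<gamma>, \<delta>]" by (fact heq)
  next
    fix \<gamma>' assume "hopscotch_eq [\<beta>, \<delta>] [\<alpha>, \<beta>] [\<alpha>, \<gamma>'] [\<gamma>', \<delta>]"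
    \<comment> \<open>The first component of the result already determines the shape.\<close>
    then have "[prepend 1 \<alpha>, prepend 1 \<gamma>] \<simeq> [\<alpha>, \<gamma>']"
      by (simp add: hopscotch_eq_def hop)
    then show "\<gamma>' = \<gamma>"
      by (rule vshift_eq_prepend_one_unique[OF \<alpha>])
  qed
  with cover strip less heq show ?thesis
    by auto
qed

end
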